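(* Let $(\mathfrak g,\cdot_{\mathfrak g},\mathfrak B)$ be a pseudo-Hessian pre-Lie algebra and $N$ a para-complex structure on the pre-Lie algebra $(\mathfrak g,\cdot_{\mathfrak g})$. Then $(\mathfrak g,\cdot_{\mathfrak g},\mathfrak B,N)$ is a para-complex pseudo-Hessian pre-Lie algebra if and only if there exist two isotropic pre-Lie subalgebras $\mathfrak g^+$ and $\mathfrak g^-$ (with respect to the symmetric bilinear form $\mathfrak B$) of the pseudo-Hessian pre-Lie algebra $(\mathfrak g,\cdot_{\mathfrak g},\mathfrak B)$ such that $\dim(\mathfrak g^+)=\dim(\mathfrak g^-)$ and $\mathfrak g=\mathfrak g^+\oplus\mathfrak g^-$ as the direct sum of vector spaces.
   Context: $\mathbb K$ is an algebraically closed field of characteristic $0$; vector spaces are finite dimensional over $\mathbb K$. A pre-Lie algebra is a vector space $\mathfrak g$ with a bilinear product $\cdot_{\mathfrak g}$ such that $(x\cdot_{\mathfrak g} y)\cdot_{\mathfrak g} z-x\cdot_{\mathfrak g}(y\cdot_{\mathfrak g} z)$ is symmetric in $x,y$. A pseudo-Hessian pre-Lie algebra $(\mathfrak g,\cdot_{\mathfrak g},\mathfrak B)$ is a pre-Lie algebra with a nondegenerate symmetric bilinear form $\mathfrak B$ (a pseudo-Hessian structure) satisfying $\mathfrak B(x\cdot_{\mathfrak g}y,z)-\mathfrak B(x,y\cdot_{\mathfrak g}z)=\mathfrak B(y\cdot_{\mathfrak g}x,z)-\mathfrak B(y,x\cdot_{\mathfrak g}z)$ for all $x,y,z\in\mathfrak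 g$. A Nijenhuis operator on $(\mathfrak g,\cdot_{\mathfrak g})$ is a linear map $N:\mathfrak g\to\mathfrak g$ with $N(x)\cdot_{\mathfrak g}N(y)=N\big(N(x)\cdot_{\mathfrak g}y+x\cdot_{\mathfrak g}N(y)-N(x\cdot_{\mathfrak g}y)\big)$ for all $x,y$. A para-complex structure on $(\mathfrak g,\cdot_{\mathfrak g})$ is a Nijenhuis operator $N$ with $N^2=\mathrm{Id}$ and $\dim\ker(N+\mathrm{Id})=\dim\ker(N-\mathrm{Id})$. $(\mathfrak g,\cdot_{\mathfrak g},\mathfrak B,N)$ is a para-complex pseudo-Hessian pre-Lie algebra if $\mathfrak B$ is a pseudo-Hessian structure, $N$ is a para-complex structure and $\mathfrak B(N(x),y)=-\mathfrak B(x,N(y))$ for all $x,y\in\mathfrak g$. A subspace $W$ is isotropic with respect to $\mathfrak B$ if $\mathfrak B(w,w')=0$ for all $w,w'\in W$.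
   Formalization: As printed the "if" part fails for a fixed N unrelated to g+ and g-. The formal version requires N(x+y)=x-y for x in g+, y in g-; it also proves, with the right-hand side as printed, that some N makes g para-complex pseudo-Hessian iff such g+, g- exist. *)

theory Defs
  imports "HOL-Computational_Algebra.Polynomial"
begin

text \<open>
  The vector space is the whole type \<open>'v\<close>, with scalar multiplication \<open>scale\<close>.
  \<^const>\<open>Vector_Spaces.linear\<close> includes the assumption that \<open>scale\<close> is a vector space structure.
\<close>

definition bilinear_product :: "('k::field \<Rightarrow> 'v::ab_group_add \<Rightarrow> 'v) \<Rightarrow> ('v \<Rightarrow> 'v \<Rightarrow> 'v) \<Rightarrow> bool" where
  "bilinear_product scale pl \<longleftrightarrow>
     (\<forall>x. Vector_Spaces.linear scale scale (\<lambda>y. pl x y)) \<and>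
     (\<forall>y. Vector_Spaces.linear scale scale (\<lambda>x. pl x y))"

definition bilinear_form :: "('k::field \<Rightarrow> 'v::ab_group_add \<Rightarrow> 'v) \<Rightarrow> ('v \<Rightarrow> 'v \<Rightarrow> 'k) \<Rightarrow> bool" where
  "bilinear_form scale B \<longleftrightarrow>
     (\<forall>x. Vector_Spaces.linear scale (*) (\<lambda>y. B x y)) \<and>
     (\<forall>y. Vector_Spaces.linear scale (*) (\<lambda>x. B x y))"

definition pre_Lie_algebra :: "('k::field \<Rightarrow> 'v::ab_group_add \<Rightarrow> 'v) \<Rightarrow> ('v \<Rightarrow> 'v \<Rightarrow> 'v) \<Rightarrow> bool" where
  "pre_Lie_algebra scale pl \<longleftrightarrow>
     bilinear_product scale pl \<and>
     (\<forall>x y z. pl (pl x y) z - pl x (pl y z) = pl (pl y x) z - pl y (pl x z))"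

definition pre_Lie_subalgebra ::
  "('k::field \<Rightarrow> 'v::ab_group_add \<Rightarrow> 'v) \<Rightarrow> ('v \<Rightarrow> 'v \<Rightarrow> 'v) \<Rightarrow> 'v set \<Rightarrow> bool" where
  "pre_Lie_subalgebra scale pl W \<longleftrightarrow>
     module.subspace scale W \<and> (\<forall>x\<in>W. \<forall>y\<in>W. pl x y \<in> W)"

definition pseudo_Hessian_structure ::
  "('k::field \<Rightarrow> 'v::ab_group_add \<Rightarrow> 'v) \<Rightarrow> ('v \<Rightarrow> 'v \<Rightarrow> 'v) \<Rightarrow> ('v \<Rightarrow> 'v \<Rightarrow> 'k) \<Rightarrow> bool" where
  "pseudo_Hessian_structure scale pl B \<longleftrightarrow>
     bilinear_form scale B \<and>
     (\<forall>x y. B x y = B y x) \<and>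
     (\<forall>x. (\<forall>y. B x y = 0) \<longrightarrow> x = 0) \<and>
     (\<forall>x y z. B (pl x y) z - B x (pl y z) = B (pl y x) z - B y (pl x z))"

definition pseudo_Hessian_pre_Lie_algebra ::
  "('k::field \<Rightarrow> 'v::ab_group_add \<Rightarrow> 'v) \<Rightarrow> ('v \<Rightarrow> 'v \<Rightarrow> 'v) \<Rightarrow> ('v \<Rightarrow> 'v \<Rightarrow> 'k) \<Rightarrow> bool" where
  "pseudo_Hessian_pre_Lie_algebra scale pl B \<longleftrightarrow>
     pre_Lie_algebra scale pl \<and> pseudo_Hessian_structure scale pl B"

definition Nijenhuis_operator ::
  "('k::field \<Rightarrow> 'v::ab_group_add \<Rightarrow> 'v) \<Rightarrow> ('v \<Rightarrow> 'v \<Rightarrow> 'v) \<Rightarrow> ('v \<Rightarrow> 'v) \<Rightarrow> bool" where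
  "Nijenhuis_operator scale pl N \<longleftrightarrow>
     Vector_Spaces.linear scale scale N \<and>
     (\<forall>x y. pl (N x) (N y) = N (pl (N x) y + pl x (N y) - N (pl x y)))"

definition para_complex_structure ::
  "('k::field \<Rightarrow> 'v::ab_group_add \<Rightarrow> 'v) \<Rightarrow> ('v \<Rightarrow> 'v \<Rightarrow> 'v) \<Rightarrow> ('v \<Rightarrow> 'v) \<Rightarrow> bool" where
  "para_complex_structure scale pl N \<longleftrightarrow>
     Nijenhuis_operator scale pl N \<and>
     N \<circ> N = id \<and>
     vector_space.dim scale {x. N x + x = 0} = vector_space.dim scale {x. N x - x = 0}"

definition para_complex_pseudo_Hessian_pre_Lie_algebra ::
  "('k::field \<Rightarrow> 'v::ab_group_add \<Rightarrow> 'v) \<Rightarrow> ('v \<Rightarrow> 'v \<Rightarrow> 'v) \<Rightarrow> ('v \<Rightarrow> 'v \<Rightarrow> 'k) \<Rightarrow> ('v \<Rightarrow> 'v) \<Rightarrow> bool" where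
  "para_complex_pseudo_Hessian_pre_Lie_algebra scale pl B N \<longleftrightarrow>
     pseudo_Hessian_pre_Lie_algebra scale pl B \<and>
     para_complex_structure scale pl N \<and>
     (\<forall>x y. B (N x) y = - B x (N y))"

definition isotropic :: "('v \<Rightarrow> 'v \<Rightarrow> 'k::zero) \<Rightarrow> 'v set \<Rightarrow> bool" where
  "isotropic B W \<longleftrightarrow> (\<forall>w\<in>W. \<forall>w'\<in>W. B w w' = 0)"

definition direct_sum_decomposition :: "'v::ab_group_add set \<Rightarrow> 'v set \<Rightarrow> bool" where
  "direct_sum_decomposition U W \<longleftrightarrow>
     {u + w |u w. u \<in> U \<and> w \<in> W} = UNIV \<and> U \<inter> W = {0}"

definition isotropic_subalgebra_splitting ::
  "('k::field \<Rightarrow> 'v::ab_group_add \<Rightarrow> 'v) \<Rightarrow> ('v \<Rightarrow> 'v \<Rightarrow> 'v) \<Rightarrow> ('v \<Rightarrow> 'v \<Rightarrow> 'k) \<Rightarrow> 'v set \<Rightarrow> 'v set \<Rightarrow> bool" where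
  "isotropic_subalgebra_splitting scale pl B gp gm \<longleftrightarrow>
     pre_Lie_subalgebra scale pl gp \<and> isotropic B gp \<and>
     pre_Lie_subalgebra scale pl gm \<and> isotropic B gm \<and>
     vector_space.dim scale gp = vector_space.dim scale gm \<and>
     direct_sum_decomposition gp gm"

end

theory Submission
  imports Defs
begin

text \<open>
  The two sides of the equivalence are the same data in different guises. An operator with
  \<open>N\<^sup>2 = Id\<close> is the reflection \<open>u + w \<mapsto> u - w\<close> determined by its eigenspaces for \<open>1\<close> and \<open>-1\<close>,
  which split the space because \<open>2\<close> is invertible; conversely each splitting \<open>\<gg>\<^sup>+ \<oplus> \<gg>\<^sup>-\<close> has its
  reflection (\<open>exists_reflection\<close>), whose eigenspaces are the two summands. The remaining
  conditions correspond one by one.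

  \<^item> The Nijenhuis identity for a reflection means that the summands are closed under the product.
    On two vectors of the same summand the identity says that \<open>N\<close> acts on their product as it does
    on that summand (\<open>eigenspace_closed\<close>); on two vectors of different summands it holds for any
    product (\<open>Nijenhuis_reflection\<close>).

  \<^item> \<open>N\<close> is skew for \<open>\<BB>\<close> exactly if the summands are isotropic: on one summand skewness reads
    \<open>\<BB>(x,y) = - \<BB>(x,y)\<close>, and between the two summands it is automatic.

  \<^item> The dimension condition on \<open>N\<close> is the condition \<open>dim \<gg>\<^sup>+ = dim \<gg>\<^sup>-\<close>, the eigenspaces being
    the summands.

  A given \<open>N\<close> thus belongs to exactly the splitting whose reflection it is, which is the first
  conjunct; forgetting which \<open>N\<close> and which splitting belong together gives the second.
\<close>

section \<open>Additivity of linear and bilinear maps\<close>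

context vector_space
begin

lemma double_eq_0_iff:
  assumes "(2::'a) \<noteq> 0"
  shows "v + v = 0 \<longleftrightarrow> v = (0::'b)"
proof -
  have "v + v = scale 2 v"
    by (metis scale_left_distrib scale_one one_add_one)
  then show ?thesis using assms by simp
qed

lemma linearD:
  assumes "Vector_Spaces.linear scale s f"
  shows "f (x + y) = f x + f y" "f (x - y) = f x - f y" "f (- x) = - f x"
proof -
  interpret f: Vector_Spaces.linear scale s f by fact
  show "f (x + y) = f x + f y" "f (x - y) = f x - f y" "f (- x) = - f x"
    by (fact f.add f.diff f.neg)+
qed

lemma bilinear_productD:
  assumes "bilinear_product scale pl"
  shows "pl x (y + z) = pl x y + pl x z" "pl x (y - z) = pl x y - pl x z" "pl x (- y) = - pl x y"
    "pl (x + y) z = pl x z + pl y z" "pl (x - y) z = pl x z - pl y z" "pl (- x) y = - pl x y"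
proof -
  have l: "Vector_Spaces.linear scale scale (\<lambda>y. pl x y)"
    and r: "Vector_Spaces.linear scale scale (\<lambda>x. pl x y)" for x y
    using assms unfolding bilinear_product_def by auto
  show "pl x (y + z) = pl x y + pl x z" "pl x (y - z) = pl x y - pl x z" "pl x (- y) = - pl x y"
    "pl (x + y) z = pl x z + pl y z" "pl (x - y) z = pl x z - pl y z" "pl (- x) y = - pl x y"
    by (fact linearD[OF l] linearD[OF r])+
qed

lemma bilinear_formD:
  assumes "bilinear_form scale B"
  shows "B x (y + z) = B x y + B x z" "B x (y - z) = B x y - B x z" "B x (- y) = - B x y"
    "B (x + y) z = B x z + B y z" "B (x - y) z = B x z - B y z" "B (- x) y = - B x y"
proof -
  have l: "Vector_Spaces.linear scale (*) (\<lambda>y. B x y)"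
    and r: "Vector_Spaces.linear scale (*) (\<lambda>x. B x y)" for x y
    using assms unfolding bilinear_form_def by auto
  show "B x (y + z) = B x y + B x z" "B x (y - z) = B x y - B x z" "B x (- y) = - B x y"
    "B (x + y) z = B x z + B y z" "B (x - y) z = B x z - B y z" "B (- x) y = - B x y"
    by (fact linearD[OF l] linearD[OF r])+
qed

section \<open>Eigenspaces of a para-complex structure\<close>

lemma subspace_eigenspaces:
  assumes "Vector_Spaces.linear scale scale N"
  shows "subspace {x. N x - x = 0}" "subspace {x. N x + x = 0}"
proof -
  interpret N: Vector_Spaces.linear scale scale N by fact
  show "subspace {x. N x - x = 0}"
    by (auto simp: subspace_def N.zero N.add N.scale)
  show "subspace {x. N x + x = 0}"
    by (auto simp: subspace_def N.zero N.add N.scale algebra_simps add_eq_0_iff2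
        simp flip: scale_minus_right)
qed

lemma involution_eigenspaces_direct_sum:
  assumes two: "(2::'a) \<noteq> 0" and lin: "Vector_Spaces.linear scale scale N" and "N \<circ> N = id"
  shows "direct_sum_decomposition {x. N x - x = 0} {x. N x + x = 0}"
proof -
  interpret N: Vector_Spaces.linear scale scale N by fact
  have inv: "N (N z) = z" for z using \<open>N \<circ> N = id\<close> by (metis comp_apply id_apply)
  have "\<exists>u w. z = u + w \<and> N u - u = 0 \<and> N w + w = 0" for z
  proof (intro exI conjI)
    have "scale (1/2) (z + N z) + scale (1/2) (z - N z) = scale (1/2) (z + z)"
      by (simp flip: scale_right_distrib)
    also have "z + z = scale 2 z"
      by (metis scale_left_distrib scale_one one_add_one)
    finally show "z = scale (1/2) (z + N z) + scale (1/2) (z - N z)" using two by simp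
    show "N (scale (1/2) (z + N z)) - scale (1/2) (z + N z) = 0"
      by (simp add: N.scale N.add inv add.commute)
    show "N (scale (1/2) (z - N z)) + scale (1/2) (z - N z) = 0"
      by (simp add: N.scale N.diff inv flip: scale_right_distrib)
  qed
  moreover have "z = 0" if "N z - z = 0" "N z + z = 0" for z
    using that double_eq_0_iff[OF two, of z] by simp
  ultimately show ?thesis
    unfolding direct_sum_decomposition_def by (auto simp: N.zero)
qed

text \<open>
  For \<open>x\<close>, \<open>y\<close> fixed by \<open>N\<close> the Nijenhuis identity reads \<open>xy = 2 N(xy) - N\<^sup>2(xy) = 2 N(xy) - xy\<close>,
  so \<open>N(xy) = xy\<close>. For \<open>x\<close>, \<open>y\<close> negated by \<open>N\<close> only the sign of \<open>2 N(xy)\<close> changes.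
\<close>

lemma eigenspace_closed:
  assumes two: "(2::'a) \<noteq> 0" and bil: "bilinear_product scale pl"
    and nij: "Nijenhuis_operator scale pl N" and "N \<circ> N = id"
  shows "N x - x = 0 \<Longrightarrow> N y - y = 0 \<Longrightarrow> N (pl x y) - pl x y = 0"
    and "N x + x = 0 \<Longrightarrow> N y + y = 0 \<Longrightarrow> N (pl x y) + pl x y = 0"
proof -
  note lin = linearD[of scale N] and [simp] = bilinear_productD[OF bil]
  have N: "Vector_Spaces.linear scale scale N"
    and id: "pl (N x) (N y) = N (pl (N x) y + pl x (N y) - N (pl x y))"
    using nij unfolding Nijenhuis_operator_def by auto
  have inv: "N (N z) = z" for z using \<open>N \<circ> N = id\<close> by (metis comp_apply id_apply)
  let ?p = "pl x y"
  { assume "N x - x = 0" "N y - y = 0"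
    then have "N x = x" "N y = y" by auto
    then have "?p = N ?p + N ?p - ?p" using id by (simp add: lin[OF N] inv)
    then have "(N ?p - ?p) + (N ?p - ?p) = 0" by (simp add: algebra_simps)
    then show "N ?p - ?p = 0" using double_eq_0_iff[OF two] by blast }
  { assume "N x + x = 0" "N y + y = 0"
    then have "N x = - x" "N y = - y" by (simp_all add: add_eq_0_iff2)
    then have "?p = - N ?p - N ?p - ?p" using id by (simp add: lin[OF N] inv)
    then have "?p + (?p + N ?p) + N ?p = 0" by (simp add: algebra_simps)
    then have "(N ?p + ?p) + (N ?p + ?p) = 0" by (simp add: algebra_simps)
    then show "N ?p + ?p = 0" using double_eq_0_iff[OF two] by blast }
qed

lemma splitting_of_para_complex:
  assumes two: "(2::'a) \<noteq> 0"
    and pc: "para_complex_pseudo_Hessian_pre_Lie_algebra scale pl B N"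
  shows "isotropic_subalgebra_splitting scale pl B {x. N x - x = 0} {x. N x + x = 0}"
proof -
  have bil: "bilinear_product scale pl" and form: "bilinear_form scale B"
    and nij: "Nijenhuis_operator scale pl N" and inv: "N \<circ> N = id"
    and dim: "dim {x. N x + x = 0} = dim {x. N x - x = 0}"
    and skew: "\<And>x y. B (N x) y = - B x (N y)"
    using pc unfolding para_complex_pseudo_Hessian_pre_Lie_algebra_def
      pseudo_Hessian_pre_Lie_algebra_def pre_Lie_algebra_def pseudo_Hessian_structure_def
      para_complex_structure_def by blast+
  have lin: "Vector_Spaces.linear scale scale N"
    using nij unfolding Nijenhuis_operator_def by blast
  have self_neg: "c = 0" if "c = - c" for c :: 'a
    using that two by (metis add.right_inverse mult_2 mult_eq_0_iff)
  have "isotropic B {x. N x - x = 0}"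
  proof (unfold isotropic_def, intro ballI)
    fix x y assume "x \<in> {x. N x - x = 0}" "y \<in> {x. N x - x = 0}"
    then have "B x y = - B x y" using skew[of x y] by simp
    then show "B x y = 0" by (rule self_neg)
  qed
  moreover have "isotropic B {x. N x + x = 0}"
  proof (unfold isotropic_def, intro ballI)
    fix x y assume "x \<in> {x. N x + x = 0}" "y \<in> {x. N x + x = 0}"
    then have "N x = - x" "N y = - y" by (simp_all add: add_eq_0_iff2)
    then have "B x y = - B x y" using skew[of x y] by (simp add: bilinear_formD[OF form])
    then show "B x y = 0" by (rule self_neg)
  qed
  ultimately show ?thesis
    unfolding isotropic_subalgebra_splitting_def pre_Lie_subalgebra_def
    using subspace_eigenspaces[OF lin] eigenspace_closed[OF two bil nij inv] dim
      involution_eigenspaces_direct_sum[OF two lin inv] by auto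
qed

section \<open>The reflection of a splitting\<close>

lemma exists_reflection:
  assumes U: "subspace U" and W: "subspace W" and ds: "direct_sum_decomposition U W"
  shows "\<exists>N. Vector_Spaces.linear scale scale N \<and> (\<forall>u\<in>U. \<forall>w\<in>W. N (u + w) = u - w)"
proof -
  have "\<forall>z. \<exists>p. p \<in> U \<and> z - p \<in> W"
  proof
    fix z
    have "z \<in> {u + w |u w. u \<in> U \<and> w \<in> W}"
      using ds unfolding direct_sum_decomposition_def by blast
    then show "\<exists>p. p \<in> U \<and> z - p \<in> W" by auto
  qed
  then obtain p where p: "\<And>z. p z \<in> U" "\<And>z. z - p z \<in> W" by metis
  have p_eq: "p z = u" if "u \<in> U" "z - u \<in> W" for z u
  proof -
    have "p z - u \<in> U" using U p that by (simp add: subspace_diff)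
    moreover have "(z - u) - (z - p z) \<in> W" using W p that subspace_diff by blast
    ultimately have "p z - u \<in> U \<inter> W" by simp
    then show ?thesis using ds unfolding direct_sum_decomposition_def by simp
  qed
  have p_add: "p (x + y) = p x + p y" for x y
  proof (rule p_eq)
    show "p x + p y \<in> U" using U p subspace_add by blast
    have "(x - p x) + (y - p y) \<in> W" using W p subspace_add by blast
    then show "x + y - (p x + p y) \<in> W" by (simp add: algebra_simps)
  qed
  have p_scale: "p (scale c x) = scale c (p x)" for c x
  proof (rule p_eq)
    show "scale c (p x) \<in> U" using U p subspace_scale by blast
    have "scale c (x - p x) \<in> W" using W p subspace_scale by blast
    then show "scale c x - scale c (p x) \<in> W" by (simp add: scale_right_diff_distrib)
  qed
  \<comment> \<open>\<open>p\<close> is the projection to \<open>U\<close> along \<open>W\<close>, and \<open>2 p - Id\<close> is the reflection.\<close>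
  let ?N = "\<lambda>z. p z + p z - z"
  have "Vector_Spaces.linear scale scale ?N"
    by (unfold_locales)
      (simp_all add: p_add p_scale scale_right_distrib scale_right_diff_distrib algebra_simps)
  moreover have "?N (u + w) = u - w" if "u \<in> U" "w \<in> W" for u w
    using p_eq[of u "u + w"] that by simp
  ultimately show ?thesis by blast
qed

context
  fixes N U W
  assumes two: "(2::'a) \<noteq> 0" and U: "subspace U" and W: "subspace W"
    and ds: "direct_sum_decomposition U W"
    and N: "Vector_Spaces.linear scale scale N"
    and refl: "\<And>u w. u \<in> U \<Longrightarrow> w \<in> W \<Longrightarrow> N (u + w) = u - w"
begin

lemma decompose:
  obtains u w where "u \<in> U" "w \<in> W" "z = u + w"
proof -
  have "z \<in> {u + w |u w. u \<in> U \<and> w \<in> W}"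
    using ds unfolding direct_sum_decomposition_def by blast
  then show thesis using that by blast
qed

lemma reflection_on_summands:
  shows "u \<in> U \<Longrightarrow> N u = u" "w \<in> W \<Longrightarrow> N w = - w"
  using refl[of u 0] refl[of 0 w] subspace_0[OF U] subspace_0[OF W] by simp_all

lemma reflection_involution: "N (N z) = z"
proof -
  obtain u w where "u \<in> U" "w \<in> W" "z = u + w" by (rule decompose)
  then show ?thesis by (simp add: linearD[OF N] reflection_on_summands)
qed

lemma reflection_eigenspaces:
  shows "{x. N x - x = 0} = U" "{x. N x + x = 0} = W"
proof -
  have "z \<in> U" if "N z - z = 0" for z
  proof -
    obtain u w where z: "u \<in> U" "w \<in> W" "z = u + w" by (rule decompose)
    have "w + w = (u + w) - (u - w)" by simp
    also have "\<dots> = 0" using that z by (simp add: refl)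
    finally have "w = 0" by (simp only: double_eq_0_iff[OF two])
    then show ?thesis using z by simp
  qed
  then show "{x. N x - x = 0} = U" by (auto simp: reflection_on_summands)
  have "z \<in> W" if "N z + z = 0" for z
  proof -
    obtain u w where z: "u \<in> U" "w \<in> W" "z = u + w" by (rule decompose)
    then have "u + u = 0" using that by (simp add: refl)
    then have "u = 0" by (simp only: double_eq_0_iff[OF two])
    then show ?thesis using z by simp
  qed
  then show "{x. N x + x = 0} = W" by (auto simp: reflection_on_summands)
qed

text \<open>
  Both sides are bilinear, so the arguments may be taken from the summands. For one argument from
  each summand the terms \<open>N(x)y\<close> and \<open>x N(y)\<close> cancel, and both sides equal \<open>- xy\<close> since
  \<open>N\<^sup>2 = Id\<close>. Closure of the summands is what makes the other two cases hold.
\<close>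

lemma Nijenhuis_reflection:
  assumes bil: "bilinear_product scale pl"
    and clU: "\<And>x y. x \<in> U \<Longrightarrow> y \<in> U \<Longrightarrow> pl x y \<in> U"
    and clW: "\<And>x y. x \<in> W \<Longrightarrow> y \<in> W \<Longrightarrow> pl x y \<in> W"
  shows "Nijenhuis_operator scale pl N"
  unfolding Nijenhuis_operator_def
proof (intro conjI allI)
  fix x y
  obtain a b where x: "a \<in> U" "b \<in> W" "x = a + b" by (rule decompose)
  obtain c d where y: "c \<in> U" "d \<in> W" "y = c + d" by (rule decompose)
  have "N (pl a c) = pl a c" "N (pl b d) = - pl b d"
    using x y clU clW by (simp_all add: reflection_on_summands)
  moreover have "N (a + b) = a - b" "N (c + d) = c - d" using x y refl by simp_all
  ultimately show "pl (N x) (N y) = N (pl (N x) y + pl x (N y) - N (pl x y))"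
    by (simp only: x(3) y(3) bilinear_productD[OF bil] linearD[OF N] reflection_involution)
      (simp add: algebra_simps)
qed (rule N)

lemma skew_reflection:
  assumes form: "bilinear_form scale B" and iU: "isotropic B U" and iW: "isotropic B W"
  shows "B (N x) y = - B x (N y)"
proof -
  obtain a b where x: "a \<in> U" "b \<in> W" "x = a + b" by (rule decompose)
  obtain c d where y: "c \<in> U" "d \<in> W" "y = c + d" by (rule decompose)
  have "B a c = 0" "B b d = 0" using x y iU iW unfolding isotropic_def by auto
  then show ?thesis using x y by (simp add: refl bilinear_formD[OF form])
qed

end

lemma para_complex_of_splitting:
  assumes two: "(2::'a) \<noteq> 0"
    and hess: "pseudo_Hessian_pre_Lie_algebra scale pl B"
    and split: "isotropic_subalgebra_splitting scale pl B U W"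
    and N: "Vector_Spaces.linear scale scale N"
    and refl: "\<And>u w. u \<in> U \<Longrightarrow> w \<in> W \<Longrightarrow> N (u + w) = u - w"
  shows "para_complex_pseudo_Hessian_pre_Lie_algebra scale pl B N"
proof -
  have bil: "bilinear_product scale pl" and form: "bilinear_form scale B"
    using hess unfolding pseudo_Hessian_pre_Lie_algebra_def pre_Lie_algebra_def
      pseudo_Hessian_structure_def by blast+
  have U: "subspace U" and W: "subspace W" and ds: "direct_sum_decomposition U W"
    and iso: "isotropic B U" "isotropic B W" and dim: "dim U = dim W"
    and cl: "\<And>x y. x \<in> U \<Longrightarrow> y \<in> U \<Longrightarrow> pl x y \<in> U" "\<And>x y. x \<in> W \<Longrightarrow> y \<in> W \<Longrightarrow> pl x y \<in> W"
    using split unfolding isotropic_subalgebra_splitting_def pre_Lie_subalgebra_def by auto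
  note ctxt = two U W ds N refl
  have "Nijenhuis_operator scale pl N"
    by (rule Nijenhuis_reflection[OF ctxt bil cl])
  moreover have "N \<circ> N = id"
    using reflection_involution[OF ctxt] by (simp add: fun_eq_iff)
  moreover have "dim {x. N x + x = 0} = dim {x. N x - x = 0}"
    using reflection_eigenspaces[OF ctxt] dim by simp
  moreover have "B (N x) y = - B x (N y)" for x y
    by (rule skew_reflection[OF ctxt form iso])
  ultimately show ?thesis
    using hess unfolding para_complex_pseudo_Hessian_pre_Lie_algebra_def
      para_complex_structure_def by blast
qed

end

section \<open>The correspondence\<close>

theorem proposition7p10:
  fixes scale :: "'k::{alg_closed_field, field_char_0} \<Rightarrow> 'v::ab_group_add \<Rightarrow> 'v"
    and Basis :: "'v set"
    and pl :: "'v \<Rightarrow> 'v \<Rightarrow> 'v"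
    and B :: "'v \<Rightarrow> 'v \<Rightarrow> 'k"
  assumes "finite_dimensional_vector_space scale Basis"
    and "pseudo_Hessian_pre_Lie_algebra scale pl B"
  shows "(\<forall>N. para_complex_structure scale pl N \<longrightarrow>
            (para_complex_pseudo_Hessian_pre_Lie_algebra scale pl B N \<longleftrightarrow>
             (\<exists>gp gm. isotropic_subalgebra_splitting scale pl B gp gm \<and>
                      (\<forall>x\<in>gp. \<forall>y\<in>gm. N (x + y) = x - y))))
       \<and> ((\<exists>N. para_complex_pseudo_Hessian_pre_Lie_algebra scale pl B N) \<longleftrightarrow>
          (\<exists>gp gm. isotropic_subalgebra_splitting scale pl B gp gm))"
proof -
  interpret finite_dimensional_vector_space scale Basis by fact
  have two: "(2::'k) \<noteq> 0" by simp
  have lin: "Vector_Spaces.linear scale scale N" if "para_complex_structure scale pl N" for N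
    using that unfolding para_complex_structure_def Nijenhuis_operator_def by blast
  have to_splitting: "\<exists>gp gm. isotropic_subalgebra_splitting scale pl B gp gm \<and>
      (\<forall>x\<in>gp. \<forall>y\<in>gm. N (x + y) = x - y)"
    if pc: "para_complex_pseudo_Hessian_pre_Lie_algebra scale pl B N" for N
  proof (intro exI conjI)
    show "isotropic_subalgebra_splitting scale pl B {x. N x - x = 0} {x. N x + x = 0}"
      by (rule splitting_of_para_complex[OF two pc])
    have N: "Vector_Spaces.linear scale scale N"
      using pc lin unfolding para_complex_pseudo_Hessian_pre_Lie_algebra_def by blast
    show "\<forall>x\<in>{x. N x - x = 0}. \<forall>y\<in>{x. N x + x = 0}. N (x + y) = x - y"
      by (auto simp: linearD[OF N] add_eq_0_iff2)
  qed
  have "\<exists>N. para_complex_pseudo_Hessian_pre_Lie_algebra scale pl B N"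
    if split: "isotropic_subalgebra_splitting scale pl B gp gm" for gp gm
  proof -
    obtain N where "Vector_Spaces.linear scale scale N" "\<forall>u\<in>gp. \<forall>w\<in>gm. N (u + w) = u - w"
      using exists_reflection[of gp gm] split
      unfolding isotropic_subalgebra_splitting_def pre_Lie_subalgebra_def by blast
    then show ?thesis using para_complex_of_splitting[OF two assms(2) split] by blast
  qed
  then show ?thesis
    using to_splitting para_complex_of_splitting[OF two assms(2)] lin by blast
qed

end
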